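(* Let $H\subset\mathbb{R}^{n-1}$ be an orientable hypersurface with unit normal vector field $N$, let $\beta: I\subset\mathbb{R}\to H$ be a curve on $H$, let $\theta$ be a constant, and let $d=(0,\dots,0,1)\in\mathbb{R}^n$, where $\mathbb{R}^{n-1}$ is identified with $\mathbb{R}^{n-1}\times\{0\}\subset\mathbb{R}^n$. Then the ruled surface $$\Phi(t,s)=\beta(t)+s\bigl(\sin(\theta)\,N(\beta(t))+\cos(\theta)\,d\bigr),\qquad t\in I,\ s\in\mathbb{R},$$ in $\mathbb{R}^n$ is developable if and only if $\beta$ is a line of curvature on $H$.
   Context: The surface $\Phi$ is called the ruled surface generated by $\beta$; it is a 2-dimensional ruled surface in $\mathbb{R}^n$ with directrix $\beta$ and rulings in the direction $X(t)=\sin(\theta)N(\beta(t))+\cos(\theta)d$. Curves are taken to be regular, with tangent vector field $T=\beta'$. The ruled surface is developable if its tangent planes are parallel along each ruling, i.e. for each fixed $t$ the plane spanned by $\Phi_t(t,s)$ and $\Phi_s(t,s)=X(t)$ does not depend on $s$ (among those $s$ at which $\Phi_t$ and $\Phi_s$ are linearly independent). The shape operator of $H$ is $S(Y)=D_YN$ for tangent vectors $Y$, where $D$ is the standard covariant derivative. The curve $\beta$ is a line of curvature on $H$ if $(N\circ\beta)'=S(T)=\lambda T$ along $\beta$ for some scalar function $\lambda$.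
   Formalization: The direction "developable implies line of curvature" is stated only for sin θ ≠ 0: if sin θ = 0 the surface is a cylinder over β with rulings parallel to d, developable for every β (e.g. a helix on a circular cylinder, not a line of curvature). The converse holds for all θ. *)

theory Defs
  imports "HOL-Analysis.Analysis"
begin

text \<open>Euclidean space of dimension \<open>n - 1\<close> is \<open>'a :: euclidean_space\<close>, and Euclidean space of
  dimension \<open>n\<close> is \<open>'a \<times> real\<close>, which carries the product inner product.\<close>

definition embed :: "'a::euclidean_space \<Rightarrow> 'a \<times> real" where
  "embed x = (x, 0)"

definition e_last :: "'a::euclidean_space \<times> real" where
  "e_last = (0, 1)"

text \<open>Meant for open \<open>U\<close>: \<open>f\<close> has continuous iterated directional derivatives up to order \<open>k\<close>.\<close>

primrec Ck_on :: "nat \<Rightarrow> ('a::euclidean_space \<Rightarrow> 'b::real_normed_vector) \<Rightarrow> 'a set \<Rightarrow> bool" where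
  "Ck_on 0 f U \<longleftrightarrow> continuous_on U f"
| "Ck_on (Suc k) f U \<longleftrightarrow>
     f differentiable_on U \<and> (\<forall>v. Ck_on k (\<lambda>x. frechet_derivative f (at x) v) U)"

text \<open>Class \<open>C\<^sup>2\<close>, the least regularity for which the normal field is \<open>C\<^sup>1\<close> and hence the shape
  operator is defined; smooth hypersurfaces are a special case.\<close>

definition hypersurface :: "'a::euclidean_space set \<Rightarrow> bool" where
  "hypersurface H \<longleftrightarrow>
     (\<forall>p\<in>H. \<exists>U (f :: 'a \<Rightarrow> real). open U \<and> p \<in> U \<and> Ck_on 2 f U \<and>
        H \<inter> U = {x \<in> U. f x = 0} \<and>
        (\<forall>x\<in>H \<inter> U. frechet_derivative f (at x) \<noteq> (\<lambda>_. 0)))"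

definition tangent_space :: "'a::euclidean_space set \<Rightarrow> 'a \<Rightarrow> 'a set" where
  "tangent_space H p =
     {Y. \<exists>\<gamma> \<epsilon>. \<epsilon> > 0 \<and> \<gamma> C1_differentiable_on {-\<epsilon><..<\<epsilon>} \<and> \<gamma> ` {-\<epsilon><..<\<epsilon>} \<subseteq> H \<and>
         \<gamma> 0 = p \<and> (\<gamma> has_vector_derivative Y) (at 0)}"

text \<open>The values of \<open>N\<close> off \<open>H\<close> are irrelevant, so being \<open>C\<^sup>1\<close> on \<open>H\<close> means having local \<open>C\<^sup>1\<close>
  extensions.\<close>

definition unit_normal_field :: "'a::euclidean_space set \<Rightarrow> ('a \<Rightarrow> 'a) \<Rightarrow> bool" where
  "unit_normal_field H N \<longleftrightarrow>
     (\<forall>p\<in>H. \<exists>U F. open U \<and> p \<in> U \<and> Ck_on 1 F U \<and> (\<forall>x\<in>H \<inter> U. F x = N x)) \<and>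
     (\<forall>p\<in>H. norm (N p) = 1 \<and> (\<forall>Y\<in>tangent_space H p. N p \<bullet> Y = 0))"

text \<open>\<open>D\<^sub>Y N\<close> for a field \<open>N\<close> given only along \<open>H\<close>. The derivative within \<open>H\<close> is determined only on
  tangent vectors, so \<open>shape_operator H N p Y\<close> is meaningful only for \<open>Y \<in> tangent_space H p\<close>.\<close>

definition shape_operator :: "'a::euclidean_space set \<Rightarrow> ('a \<Rightarrow> 'a) \<Rightarrow> 'a \<Rightarrow> 'a \<Rightarrow> 'a" where
  "shape_operator H N p Y = frechet_derivative N (at p within H) Y"

text \<open>The parameter interval may contain its endpoints; derivatives there are one-sided.\<close>

definition velocity :: "real set \<Rightarrow> (real \<Rightarrow> 'a::euclidean_space) \<Rightarrow> real \<Rightarrow> 'a" where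
  "velocity I \<beta> t = vector_derivative \<beta> (at t within I)"

definition regular_curve :: "real set \<Rightarrow> (real \<Rightarrow> 'a::euclidean_space) \<Rightarrow> bool" where
  "regular_curve I \<beta> \<longleftrightarrow>
     is_interval I \<and> interior I \<noteq> {} \<and> \<beta> differentiable_on I \<and>
     continuous_on I (velocity I \<beta>) \<and> (\<forall>t\<in>I. velocity I \<beta> t \<noteq> 0)"

definition line_of_curvature ::
    "'a::euclidean_space set \<Rightarrow> ('a \<Rightarrow> 'a) \<Rightarrow> real set \<Rightarrow> (real \<Rightarrow> 'a) \<Rightarrow> bool" where
  "line_of_curvature H N I \<beta> \<longleftrightarrow>
     (\<exists>\<kappa>. \<forall>t\<in>I.
        velocity I (N \<circ> \<beta>) t = shape_operator H N (\<beta> t) (velocity I \<beta> t) \<and>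
        shape_operator H N (\<beta> t) (velocity I \<beta> t) = \<kappa> t *\<^sub>R velocity I \<beta> t)"

text \<open>If \<open>sin \<theta> = 0\<close> the rulings are all parallel to \<open>e_last\<close>, and the surface is a cylinder, which is
  developable for every \<open>\<beta>\<close>.\<close>

definition ruled_surface ::
    "('a::euclidean_space \<Rightarrow> 'a) \<Rightarrow> (real \<Rightarrow> 'a) \<Rightarrow> real \<Rightarrow> real \<Rightarrow> real \<Rightarrow> 'a \<times> real" where
  "ruled_surface N \<beta> \<theta> t s =
     embed (\<beta> t) + s *\<^sub>R (sin \<theta> *\<^sub>R embed (N (\<beta> t)) + cos \<theta> *\<^sub>R e_last)"

definition partial_t ::
    "real set \<Rightarrow> (real \<Rightarrow> real \<Rightarrow> 'b::euclidean_space) \<Rightarrow> real \<Rightarrow> real \<Rightarrow> 'b" where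
  "partial_t I \<Phi> t s = vector_derivative (\<lambda>u. \<Phi> u s) (at t within I)"

definition partial_s :: "(real \<Rightarrow> real \<Rightarrow> 'b::euclidean_space) \<Rightarrow> real \<Rightarrow> real \<Rightarrow> 'b" where
  "partial_s \<Phi> t s = vector_derivative (\<lambda>u. \<Phi> t u) (at s)"

text \<open>The first conjunct excludes \<open>u = v\<close>, when the set \<open>{u, v}\<close> collapses to a singleton.\<close>

definition lin_indep_pair :: "'b::real_vector \<Rightarrow> 'b \<Rightarrow> bool" where
  "lin_indep_pair u v \<longleftrightarrow> u \<noteq> v \<and> independent {u, v}"

definition developable :: "real set \<Rightarrow> (real \<Rightarrow> real \<Rightarrow> 'b::euclidean_space) \<Rightarrow> bool" where
  "developable I \<Phi> \<longleftrightarrow>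
     (\<forall>t\<in>I. \<forall>s s'.
        lin_indep_pair (partial_t I \<Phi> t s) (partial_s \<Phi> t s) \<longrightarrow>
        lin_indep_pair (partial_t I \<Phi> t s') (partial_s \<Phi> t s') \<longrightarrow>
        span {partial_t I \<Phi> t s, partial_s \<Phi> t s} = span {partial_t I \<Phi> t s', partial_s \<Phi> t s'})"

end

theory Submission
  imports Defs
begin

text \<open>Along \<open>\<beta>\<close> write \<open>T = \<beta>'\<close> and \<open>W = (N \<circ> \<beta>)'\<close>; the chain rule gives \<open>W = S(T)\<close>, and both \<open>T\<close> and
  \<open>W\<close> are orthogonal to \<open>N\<close>. The partial derivatives of the surface are \<open>T + s sin \<theta> W\<close> and
  \<open>X = sin \<theta> N + cos \<theta> d\<close>, which are orthogonal. If \<open>W = \<kappa> T\<close>, every nondegenerate tangent plane is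
  spanned by \<open>T\<close> and \<open>X\<close>. Conversely, comparing the planes at \<open>s = 0\<close> and \<open>s = 1\<close> puts
  \<open>T + sin \<theta> W\<close> in the span of \<open>T\<close> and \<open>X\<close>, and orthogonality to \<open>X\<close> makes it a multiple of \<open>T\<close>.\<close>

section \<open>Linear algebra of a pair of vectors and its span\<close>

lemma lin_indep_pair_orthogonal:
  fixes u v :: "'b::euclidean_space"
  assumes "u \<noteq> 0" "v \<noteq> 0" "u \<bullet> v = 0"
  shows "lin_indep_pair u v"
proof -
  have "u \<noteq> v" using assms by auto
  moreover have "pairwise orthogonal {u, v}"
    using assms by (auto simp: pairwise_def orthogonal_def inner_commute)
  ultimately show ?thesis
    unfolding lin_indep_pair_def using assms by (simp add: pairwise_orthogonal_independent)
qed

lemma lin_indep_pair_nonzero: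
  "lin_indep_pair u v \<Longrightarrow> u \<noteq> 0"
  unfolding lin_indep_pair_def using dependent_zero by blast

lemma span_pair_scale:
  fixes u v :: "'b::real_vector"
  assumes "c \<noteq> 0"
  shows "span {c *\<^sub>R u, v} = span {u, v}"
proof -
  have "u = (1 / c) *\<^sub>R (c *\<^sub>R u)" using assms by simp
  then have "u \<in> span {c *\<^sub>R u, v}"
    by (metis insertI1 span_base span_scale)
  then show ?thesis
    by (auto simp: span_eq intro: span_scale span_base)
qed

text \<open>Pairing \<open>w = a *\<^sub>R u + b *\<^sub>R v\<close> with \<open>v\<close> leaves
  \<open>b * (v \<bullet> v) = 0\<close>, so the \<open>v\<close>-term vanishes. This turns equality
  of two tangent planes into proportionality of vectors.\<close>

lemma multiple_if_in_span_orthogonal: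
  fixes u v w :: "'b::euclidean_space"
  assumes "w \<in> span {u, v}" "u \<bullet> v = 0" "w \<bullet> v = 0"
  shows "\<exists>a. w = a *\<^sub>R u"
proof -
  obtain a b where ab: "w = a *\<^sub>R u + b *\<^sub>R v"
  proof -
    from assms(1) obtain a where "w - a *\<^sub>R u \<in> span {v}"
      using span_breakdown_eq by blast
    then obtain b where "w - a *\<^sub>R u = b *\<^sub>R v"
      unfolding span_singleton by blast
    then show ?thesis by (intro that[of a b]) (simp add: algebra_simps)
  qed
  then have "b * (v \<bullet> v) = 0"
    using assms(2,3) by (simp add: inner_left_distrib)
  then have "b *\<^sub>R v = 0" by auto
  with ab have "w = a *\<^sub>R u" by (simp only: add_0_right)
  then show ?thesis by blast
qed

section \<open>Derivatives within the parameter interval and along the hypersurface\<close>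

text \<open>A connected set with more than one point has no isolated points. Uniqueness of
  derivatives within \<open>I\<close>, endpoints included, rests on this.\<close>

lemma nontrivial_at_within_interval:
  fixes I :: "real set"
  assumes "is_interval I" "interior I \<noteq> {}" "t \<in> I"
  shows "at t within I \<noteq> bot"
proof -
  have "\<not> I \<subseteq> {t}"
    using assms(2) interior_mono interior_singleton by (metis subset_empty)
  then have "t islimpt I"
    using assms connected_imp_perfect is_interval_connected by blast
  then show ?thesis by (simp add: trivial_limit_within)
qed

text \<open>A local extension \<open>F\<close> agrees with \<open>N\<close> on \<open>H\<close> near
  \<open>p\<close>, so its derivative within \<open>H\<close> is also one of \<open>N\<close>. Such
  a derivative need not be unique; what matters is that the one selected by
  \<open>shape_operator\<close> is a genuine derivative.\<close>

lemma unit_normal_field_differentiable: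
  assumes "unit_normal_field H N" "p \<in> H"
  shows "(N has_derivative shape_operator H N p) (at p within H)"
proof -
  from assms obtain U F where U: "open U" "p \<in> U" "Ck_on 1 F U" "\<And>x. x \<in> H \<inter> U \<Longrightarrow> F x = N x"
    unfolding unit_normal_field_def by blast
  then have "F differentiable_on U" by (simp add: numeral_eq_Suc)
  then have "F differentiable at p"
    using U(1,2) by (simp add: differentiable_on_eq_differentiable_at)
  then have "F differentiable at p within H"
    by (rule differentiable_at_withinI)
  then obtain D where D: "(F has_derivative D) (at p within H)"
    unfolding differentiable_def by blast
  have "(N has_derivative D) (at p within H)"
  proof (rule has_derivative_transform_eventually[OF D])
    show "\<forall>\<^sub>F x in at p within H. F x = N x"
      using U unfolding eventually_at_topological by blast
  qed (use U(2,4) assms(2) in auto)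
  then have "N differentiable at p within H"
    unfolding differentiable_def by blast
  then show ?thesis
    unfolding shape_operator_def[abs_def] using frechet_derivative_works by (metis eta_contract_eq)
qed

lemma regular_curve_has_velocity:
  assumes "regular_curve I \<beta>" "t \<in> I"
  shows "(\<beta> has_vector_derivative velocity I \<beta> t) (at t within I)"
  using assms unfolding regular_curve_def velocity_def differentiable_on_def
  by (simp add: vector_derivative_works)

text \<open>The witness is \<beta> with its parameter shifted by \<open>t\<close> and restricted to
  a ball inside the interior of \<open>I\<close>, where derivatives within \<open>I\<close> are
  two-sided.\<close>

lemma velocity_in_tangent_space:
  assumes reg: "regular_curve I \<beta>" and sub: "\<beta> ` I \<subseteq> H" and t: "t \<in> interior I"
  shows "velocity I \<beta> t \<in> tangent_space H (\<beta> t)"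
proof -
  obtain e where e: "e > 0" "ball t e \<subseteq> interior I"
    using t open_contains_ball by blast
  define J where "J = {-e<..<e}"
  have shift: "t + u \<in> interior I" if "u \<in> J" for u
    using e that by (auto simp: J_def subset_iff dist_real_def)
  have der: "((\<lambda>u. \<beta> (t + u)) has_vector_derivative velocity I \<beta> (t + u)) (at u)" if "u \<in> J" for u
  proof -
    have "(\<beta> has_vector_derivative velocity I \<beta> (t + u)) (at (t + u))"
      using regular_curve_has_velocity[OF reg, of "t + u"] shift[OF that] interior_subset
      by (metis at_within_interior subsetD)
    moreover have "((\<lambda>u. t + u) has_vector_derivative 1) (at u)"
      by (auto intro!: derivative_eq_intros)
    ultimately show ?thesis
      using vector_diff_chain_at[of "\<lambda>u. t + u" 1 u \<beta>] by (simp add: o_def)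
  qed
  have "continuous_on J (\<lambda>u. velocity I \<beta> (t + u))"
  proof (rule continuous_on_compose2[of I "velocity I \<beta>"])
    show "continuous_on I (velocity I \<beta>)"
      using reg by (simp add: regular_curve_def)
    show "(+) t ` J \<subseteq> I"
      using shift interior_subset by fast
  qed (intro continuous_intros)
  then have "(\<lambda>u. \<beta> (t + u)) C1_differentiable_on J"
    unfolding C1_differentiable_on_def using der by (intro exI[of _ "\<lambda>u. velocity I \<beta> (t + u)"]) simp
  moreover have "(\<lambda>u. \<beta> (t + u)) ` J \<subseteq> H"
    using shift sub interior_subset by blast
  ultimately show ?thesis
    unfolding tangent_space_def using e(1) der[of 0]
    by (auto simp: J_def intro!: exI[of _ "\<lambda>u. \<beta> (t + u)"] exI[of _ e])
qed

text \<open>Only at interior parameters is the velocity visibly in \<open>tangent_space\<close>, whose curves are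
  two-sided; the endpoints follow by continuity.\<close>

lemma normal_orthogonal_velocity:
  assumes N: "unit_normal_field H N" and reg: "regular_curve I \<beta>" and sub: "\<beta> ` I \<subseteq> H"
    and t: "t \<in> I"
  shows "N (\<beta> t) \<bullet> velocity I \<beta> t = 0"
proof -
  let ?g = "\<lambda>t. N (\<beta> t) \<bullet> velocity I \<beta> t"
  have "continuous_on H N"
    using unit_normal_field_differentiable[OF N] has_derivative_continuous
    unfolding continuous_on_eq_continuous_within by blast
  moreover have "continuous_on I \<beta>" "continuous_on I (velocity I \<beta>)"
    using reg unfolding regular_curve_def by (auto intro: differentiable_imp_continuous_on)
  ultimately have cont: "continuous_on I ?g"
    using sub by (auto intro!: continuous_on_inner continuous_on_compose2[of H N I \<beta>])
  have zero: "?g u = 0" if "u \<in> interior I" for u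
    using velocity_in_tangent_space[OF reg sub that] N sub that interior_subset
    unfolding unit_normal_field_def by blast
  \<comment> \<open>Convexity and nonempty interior make the interior dense in \<open>I\<close>, so
    every endpoint is a limit of interior parameters.\<close>
  have "closure (interior I) = closure I"
    using reg by (simp add: regular_curve_def convex_closure_interior is_interval_convex)
  then have tc: "t \<in> closure (interior I)"
    using t closure_subset by blast
  then obtain x where x: "\<And>n. x n \<in> interior I" "x \<longlonglongrightarrow> t"
    unfolding closure_sequential by blast
  have "(\<lambda>n. ?g (x n)) \<longlonglongrightarrow> ?g t"
    using continuous_on_tendsto_compose[OF cont x(2) t] x(1) interior_subset
    by (metis (mono_tags, lifting) eventually_sequentiallyI subsetD)
  then show ?thesis using zero[OF x(1)] by (simp add: LIMSEQ_const_iff)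
qed

text \<open>Chain rule: the derivative of \<open>N\<close> within \<open>H\<close> restricts to the
  image of \<beta>, and linearity turns the composite derivative at \<open>h\<close> into
  \<open>h\<close> times the shape operator of the velocity.\<close>

lemma normal_along_curve_derivative:
  assumes N: "unit_normal_field H N" and reg: "regular_curve I \<beta>" and sub: "\<beta> ` I \<subseteq> H"
    and t: "t \<in> I"
  shows "((N \<circ> \<beta>) has_vector_derivative shape_operator H N (\<beta> t) (velocity I \<beta> t)) (at t within I)"
proof -
  have b: "\<beta> t \<in> H" using sub t by blast
  have "(N has_derivative shape_operator H N (\<beta> t)) (at (\<beta> t) within \<beta> ` I)"
    using unit_normal_field_differentiable[OF N b] sub has_derivative_subset by blast
  from diff_chain_within[OF regular_curve_has_velocity[OF reg t, unfolded has_vector_derivative_def] this]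
  show ?thesis
    using has_derivative_linear[OF unit_normal_field_differentiable[OF N b]]
    by (simp add: has_vector_derivative_def o_def linear_cmul)
qed

text \<open>Differentiate the constant function
  \<open>N (\<beta> u) \<bullet> N (\<beta> u) = 1\<close> on \<open>I\<close>.\<close>

lemma normal_orthogonal_derivative:
  assumes N: "unit_normal_field H N" and reg: "regular_curve I \<beta>" and sub: "\<beta> ` I \<subseteq> H"
    and t: "t \<in> I"
  shows "N (\<beta> t) \<bullet> shape_operator H N (\<beta> t) (velocity I \<beta> t) = 0"
proof -
  let ?W = "shape_operator H N (\<beta> t) (velocity I \<beta> t)"
  have W: "((\<lambda>u. N (\<beta> u)) has_vector_derivative ?W) (at t within I)"
    using normal_along_curve_derivative[OF assms] by (simp add: o_def)
  have "((\<lambda>u. N (\<beta> u) \<bullet> N (\<beta> u)) has_vector_derivative (N (\<beta> t) \<bullet> ?W + ?W \<bullet> N (\<beta> t))) (at t within I)"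
    using bounded_bilinear.has_vector_derivative[OF bounded_bilinear_inner W W] .
  moreover have "((\<lambda>u. N (\<beta> u) \<bullet> N (\<beta> u)) has_vector_derivative 0) (at t within I)"
  proof (rule has_vector_derivative_transform[OF t])
    show "((\<lambda>u. 1 :: real) has_vector_derivative 0) (at t within I)" by simp
    show "N (\<beta> u) \<bullet> N (\<beta> u) = 1" if "u \<in> I" for u
      using N sub that unfolding unit_normal_field_def by (auto simp: dot_square_norm)
  qed
  moreover have "at t within I \<noteq> bot"
    using reg t nontrivial_at_within_interval unfolding regular_curve_def by blast
  ultimately have "N (\<beta> t) \<bullet> ?W + ?W \<bullet> N (\<beta> t) = 0"
    using vector_derivative_unique_within by blast
  then show ?thesis by (simp add: inner_commute)
qed

section \<open>Partial derivatives of the surface and the pointwise curvature condition\<close>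

lemma partial_s_ruled_surface:
  "partial_s (ruled_surface N \<beta> \<theta>) t s = (sin \<theta> *\<^sub>R N (\<beta> t), cos \<theta>)"
  unfolding partial_s_def ruled_surface_def embed_def e_last_def
  by (rule vector_derivative_at) (auto intro!: derivative_eq_intros)

text \<open>The last coordinate \<open>s * cos \<theta>\<close> is constant in \<open>t\<close>, so
  only the part in the smaller space is differentiated.\<close>

lemma partial_t_ruled_surface:
  assumes N: "unit_normal_field H N" and reg: "regular_curve I \<beta>" and sub: "\<beta> ` I \<subseteq> H"
    and t: "t \<in> I"
  shows "partial_t I (ruled_surface N \<beta> \<theta>) t s =
    (velocity I \<beta> t + (s * sin \<theta>) *\<^sub>R shape_operator H N (\<beta> t) (velocity I \<beta> t), 0)"
proof -
  let ?W = "shape_operator H N (\<beta> t) (velocity I \<beta> t)"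
  have W: "((\<lambda>u. N (\<beta> u)) has_vector_derivative ?W) (at t within I)"
    using normal_along_curve_derivative[OF assms] by (simp add: o_def)
  have "((\<lambda>u. \<beta> u + (s * sin \<theta>) *\<^sub>R N (\<beta> u)) has_vector_derivative
      (velocity I \<beta> t + (s * sin \<theta>) *\<^sub>R ?W)) (at t within I)"
    using has_vector_derivative_add[OF regular_curve_has_velocity[OF reg t]
      bounded_linear.has_vector_derivative[OF bounded_linear_scaleR_right W]] .
  then have "((\<lambda>u. (\<beta> u + (s * sin \<theta>) *\<^sub>R N (\<beta> u), s * cos \<theta>)) has_vector_derivative
      (velocity I \<beta> t + (s * sin \<theta>) *\<^sub>R ?W, 0)) (at t within I)"
    by (intro has_vector_derivative_Pair) auto
  moreover have "at t within I \<noteq> bot"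
    using reg t nontrivial_at_within_interval unfolding regular_curve_def by blast
  ultimately show ?thesis
    unfolding partial_t_def ruled_surface_def embed_def e_last_def
    by (simp add: vector_derivative_within)
qed

text \<open>The chain rule supplies the first equation of the definition, and the factors \<kappa>
  can be chosen separately for each \<open>t\<close> because no regularity of \<kappa> is
  demanded.\<close>

lemma line_of_curvature_iff:
  assumes N: "unit_normal_field H N" and reg: "regular_curve I \<beta>" and sub: "\<beta> ` I \<subseteq> H"
  shows "line_of_curvature H N I \<beta> \<longleftrightarrow>
    (\<forall>t\<in>I. \<exists>k. shape_operator H N (\<beta> t) (velocity I \<beta> t) = k *\<^sub>R velocity I \<beta> t)"
proof -
  have "velocity I (N \<circ> \<beta>) t = shape_operator H N (\<beta> t) (velocity I \<beta> t)" if "t \<in> I" for t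
    unfolding velocity_def[of _ "N \<circ> \<beta>"]
    using normal_along_curve_derivative[OF assms that] reg that nontrivial_at_within_interval
    by (auto simp: regular_curve_def intro!: vector_derivative_within)
  then show ?thesis
    unfolding line_of_curvature_def by (auto simp: bchoice_iff)
qed

theorem theorem4p1:
  fixes H :: "'a::euclidean_space set" and N :: "'a \<Rightarrow> 'a"
    and I :: "real set" and \<beta> :: "real \<Rightarrow> 'a" and \<theta> :: real
  assumes "hypersurface H" and "unit_normal_field H N"
    and "regular_curve I \<beta>" and "\<beta> ` I \<subseteq> H"
  shows "(line_of_curvature H N I \<beta> \<longrightarrow> developable I (ruled_surface N \<beta> \<theta>)) \<and>
         (sin \<theta> \<noteq> 0 \<longrightarrow> developable I (ruled_surface N \<beta> \<theta>) \<longrightarrow> line_of_curvature H N I \<beta>)"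
proof (intro conjI impI)
  let ?T = "velocity I \<beta>"
  let ?W = "\<lambda>t. shape_operator H N (\<beta> t) (?T t)"
  let ?X = "\<lambda>t. (sin \<theta> *\<^sub>R N (\<beta> t), cos \<theta>)"
  note curv = line_of_curvature_iff[OF assms(2-4)]
  note partials = partial_s_ruled_surface partial_t_ruled_surface[OF assms(2-4)]
  {
    assume "line_of_curvature H N I \<beta>"
    then have par: "\<exists>k. ?W t = k *\<^sub>R ?T t" if "t \<in> I" for t
      using curv that by blast
    have plane: "span {partial_t I (ruled_surface N \<beta> \<theta>) t s, partial_s (ruled_surface N \<beta> \<theta>) t s}
        = span {(?T t, 0), ?X t}"
      if t: "t \<in> I"
        and ind: "lin_indep_pair (partial_t I (ruled_surface N \<beta> \<theta>) t s)
          (partial_s (ruled_surface N \<beta> \<theta>) t s)" for t s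
    proof -
      obtain k where "?W t = k *\<^sub>R ?T t" using par[OF t] by blast
      then have eq: "partial_t I (ruled_surface N \<beta> \<theta>) t s = (1 + s * sin \<theta> * k) *\<^sub>R (?T t, 0)"
        by (simp add: partials(2)[OF t] algebra_simps)
      \<comment> \<open>A zero of this factor is a singular point on the ruling, where the first
        partial derivative vanishes; independence excludes it.\<close>
      with lin_indep_pair_nonzero[OF ind] have "1 + s * sin \<theta> * k \<noteq> 0"
        by (auto simp: zero_prod_def)
      then show ?thesis
        unfolding eq partials(1) by (rule span_pair_scale)
    qed
    then show "developable I (ruled_surface N \<beta> \<theta>)"
      unfolding developable_def by blast
  }
  assume sin: "sin \<theta> \<noteq> 0" and dev: "developable I (ruled_surface N \<beta> \<theta>)"
  have "\<exists>k. ?W t = k *\<^sub>R ?T t" if t: "t \<in> I" for t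
  proof -
    define V where "V = ?T t + sin \<theta> *\<^sub>R ?W t"
    have T0: "?T t \<noteq> 0" using assms(3) t by (simp add: regular_curve_def)
    have NT: "?T t \<bullet> N (\<beta> t) = 0"
      using normal_orthogonal_velocity[OF assms(2-4) t] by (simp add: inner_commute)
    have NV: "V \<bullet> N (\<beta> t) = 0"
      using NT normal_orthogonal_derivative[OF assms(2-4) t]
      by (simp add: V_def inner_right_distrib inner_commute[of _ "N (\<beta> t)"])
    have "norm (N (\<beta> t)) = 1"
      using assms(2,4) t unfolding unit_normal_field_def by blast
    then have X0: "?X t \<noteq> 0" using sin by (auto simp: zero_prod_def)
    have "\<exists>a. V = a *\<^sub>R ?T t"
    \<comment> \<open>\<open>V\<close> is the first component of the \<open>t\<close>-partial at
      \<open>s = 1\<close>. If it vanishes, the plane there is degenerate and developability gives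
      nothing, but \<open>V\<close> is then trivially a multiple of the velocity.\<close>
    proof (cases "V = 0")
      case True
      then show ?thesis by (intro exI[of _ 0]) simp
    next
      case False
      have p: "partial_t I (ruled_surface N \<beta> \<theta>) t 0 = (?T t, 0)"
        "partial_t I (ruled_surface N \<beta> \<theta>) t 1 = (V, 0)"
        by (simp_all add: partials(2)[OF t] V_def)
      have "lin_indep_pair (?T t, 0) (?X t)" "lin_indep_pair (V, 0) (?X t)"
        using T0 X0 NT NV False
        by (auto intro!: lin_indep_pair_orthogonal simp: zero_prod_def)
      then have "span {(?T t, 0), ?X t} = span {(V, 0), ?X t}"
        using dev[unfolded developable_def, rule_format, OF t, of 0 1] unfolding p partials(1) by simp
      then have "(V, 0) \<in> span {(?T t, 0), ?X t}"
        by (simp add: span_base)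
      then have "\<exists>a. (V, 0) = a *\<^sub>R (?T t, 0 :: real)"
        by (rule multiple_if_in_span_orthogonal) (simp_all add: NT NV)
      then show ?thesis by auto
    qed
    then obtain a where "V = a *\<^sub>R ?T t" by blast
    then have "sin \<theta> *\<^sub>R ?W t = (a - 1) *\<^sub>R ?T t"
      unfolding V_def by (simp add: algebra_simps)
    \<comment> \<open>The curvature factor is \<open>(a - 1) / sin \<theta>\<close>. For
      \<open>sin \<theta> = 0\<close>, \<open>V\<close> would be the velocity itself and carry no
      information about \<open>?W t\<close>.\<close>
    then have "(1 / sin \<theta>) *\<^sub>R (sin \<theta> *\<^sub>R ?W t) = ((a - 1) / sin \<theta>) *\<^sub>R ?T t"
      by simp
    then show ?thesis using sin by auto
  qed
  then show "line_of_curvature H N I \<beta>" using curv by blast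
qed

end
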